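(* Let $h\geq2$ and $a\geq1$ be integers, and let $n=2h(a+1)$ be the order of $\mathcal{S}_{2h}(a)$. Then the characteristic polynomial of $\mathcal{S}_{2h}(a)$ is $$p_{\mathcal{S}_{2h}(a)}(\lambda)=\lambda^{\,2h(a-1)+2}\,\bigl(\lambda^2-2a-4\bigr)\,U_{h-1}(\lambda)^2.$$
   Context: For a graph $G$ of order $n$ with adjacency matrix $A(G)$, $p_G(\lambda)=\det(\lambda I_n-A(G))$. For integers $h\geq2$ and $a\geq1$, $\mathcal{S}_{2h}(a)$ is the graph obtained from the cycle $C_{2h}=v_1v_2\cdots v_{2h}v_1$ by attaching no pendant vertex to $v_1$, exactly $2a$ pendant vertices to the antipodal vertex $v_{h+1}$, and exactly $a$ pendant vertices to each of the remaining $2h-2$ cycle vertices. For the fixed integer $a\geq1$, the polynomials $U_j=U_j(\lambda)$ are defined by $U_0=1$, $U_1=\lambda^2-a$, and $U_j=(\lambda^2-a)U_{j-1}-\lambda^2U_{j-2}$ for $j\geq2$. *)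

theory Defs
  imports
    "Jordan_Normal_Form.Char_Poly"
    "Graph_Theory.Pair_Digraph"
begin

(* Finite simple graphs are the symmetric loop-free pair digraphs (locale pair_graph):
   the edge {u,v} is represented by the two arcs (u,v) and (v,u).  The adjacency matrix is
   taken with respect to an ordering vs of the vertices, i.e. a duplicate-free list of them. *)

definition adjacency_matrix :: "'v pair_pre_digraph \<Rightarrow> 'v list \<Rightarrow> real mat" where
  "adjacency_matrix G vs =
     mat (length vs) (length vs) (\<lambda>(i, j). if (vs ! i, vs ! j) \<in> parcs G then 1 else 0)"

(* The cycle on 1, ..., m; since i mod m + 1 is the cyclic successor of i, the closing edge
   {m, 1} is included.  A simple graph only for m \<ge> 3. *)
definition cycle_graph :: "nat \<Rightarrow> nat pair_pre_digraph" where
  "cycle_graph m =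
     \<lparr> pverts = {1..m},
       parcs = {(i, j). i \<in> {1..m} \<and> j \<in> {1..m} \<and> (j = i mod m + 1 \<or> i = j mod m + 1)} \<rparr>"

(* Attach c v pendant vertices to every vertex v of G: Inl v is the old vertex v, and
   Inr (v, k) with k < c v are the new neighbours of v, each of degree one. *)
definition attach_pendants ::
  "'v pair_pre_digraph \<Rightarrow> ('v \<Rightarrow> nat) \<Rightarrow> ('v + 'v \<times> nat) pair_pre_digraph" where
  "attach_pendants G c =
     \<lparr> pverts = Inl ` pverts G \<union> {Inr (v, k) | v k. v \<in> pverts G \<and> k < c v},
       parcs = {(Inl u, Inl v) | u v. (u, v) \<in> parcs G}
             \<union> {(Inl v, Inr (v, k)) | v k. v \<in> pverts G \<and> k < c v}
             \<union> {(Inr (v, k), Inl v) | v k. v \<in> pverts G \<and> k < c v} \<rparr>"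

definition S_graph :: "nat \<Rightarrow> nat \<Rightarrow> (nat + nat \<times> nat) pair_pre_digraph" where
  "S_graph h a =
     attach_pendants (cycle_graph (2 * h))
       (\<lambda>i. if i = 1 then 0 else if i = h + 1 then 2 * a else a)"

fun U :: "nat \<Rightarrow> nat \<Rightarrow> real poly" where
  "U a 0 = 1"
| "U a (Suc 0) = monom 1 2 - of_nat a"
| "U a (Suc (Suc j)) = (monom 1 2 - of_nat a) * U a (Suc j) - monom 1 2 * U a j"

lemma pair_graph_cycle_graph:
  assumes "m \<ge> 3"
  shows "pair_graph (cycle_graph m)"
proof -
  have fin: "finite (parcs (cycle_graph m))"
    by (rule finite_subset[of _ "{1..m} \<times> {1..m}"]) (auto simp: cycle_graph_def)
  have loop: "Suc (i mod m) \<noteq> i" if "i \<le> m" for i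
    using that assms by (cases "i = m") auto
  show ?thesis
    by unfold_locales
      (use fin loop loop[symmetric] in
        \<open>auto simp: cycle_graph_def symmetric_def sym_def arcs_ends_def arc_to_ends_def
          with_proj_def image_iff\<close>)
qed

lemma pair_graph_attach_pendants:
  assumes "pair_graph G"
  shows "pair_graph (attach_pendants G c)"
proof -
  interpret pair_graph G by fact
  have verts: "pverts (attach_pendants G c) = Inl ` pverts G \<union> Inr ` (SIGMA v:pverts G. {..<c v})"
    by (auto simp: attach_pendants_def)
  have fin: "finite (pverts (attach_pendants G c))"
    unfolding verts by (auto intro!: finite_SigmaI)
  have mem: "u \<in> pverts G" "v \<in> pverts G" if "(u, v) \<in> parcs G" for u v
    using arc_fst_in_verts[OF that] arc_snd_in_verts[OF that] by auto
  have wf: "parcs (attach_pendants G c) \<subseteq>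
      pverts (attach_pendants G c) \<times> pverts (attach_pendants G c)"
    using mem by (auto simp: attach_pendants_def)
  have sym: "(v, u) \<in> parcs G" if "(u, v) \<in> parcs G" for u v
    using that pair_sym_arcs by (auto simp: symmetric_def sym_def)
  show ?thesis
  proof
    show "finite (parcs (attach_pendants G c))"
      using finite_subset[OF wf] fin by blast
    show "symmetric (with_proj (attach_pendants G c))"
      using sym by (auto simp: attach_pendants_def symmetric_def sym_def)
  qed (use fin mem pair_no_loops in \<open>auto simp: attach_pendants_def\<close>)
qed

lemma pair_graph_S_graph: "h \<ge> 2 \<Longrightarrow> pair_graph (S_graph h a)"
  unfolding S_graph_def by (intro pair_graph_attach_pendants pair_graph_cycle_graph) auto

end

theory Submission
  imports Defs
begin

text \<open>
  Let \<open>X\<close> be the indeterminate. Eliminating the pendant vertices by a Schur complement reduces the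
  characteristic polynomial to the determinant of the cyclic matrix with off-diagonal entries
  \<open>- X\<close> and diagonal entries \<open>X\<^sup>2 - c\<^sub>i\<close>, where \<open>c\<^sub>i\<close> is the number of pendants at \<open>i\<close>. This
  matrix is invariant under the reflection of the cycle that fixes \<open>1\<close> and \<open>h + 1\<close>. The
  antisymmetric part is tridiagonal with constant diagonal \<open>X\<^sup>2 - a\<close> and contributes a factor
  \<open>U\<^sub>h\<^sub>-\<^sub>1\<close>; the symmetric part is tridiagonal with doubled couplings at both ends, and its
  determinant is \<open>X\<^sup>2 (X\<^sup>2 - 2 a - 4) U\<^sub>h\<^sub>-\<^sub>1\<close> by the recurrence for \<open>U\<close>.
\<close>

section \<open>Determinants indexed by lists of labels\<close>

text \<open>Rows and columns have separate label lists so that minors off the diagonal can also be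
  expressed. The size is read off \<open>rs\<close>; \<open>cs\<close> is meant to have the same
  length.\<close>

definition list_det :: "('u \<Rightarrow> 'v \<Rightarrow> 'a :: comm_ring_1) \<Rightarrow> 'u list \<Rightarrow> 'v list \<Rightarrow> 'a" where
  "list_det f rs cs = det (mat (length rs) (length rs) (\<lambda>(i, j). f (rs ! i) (cs ! j)))"

lemma list_det_Nil [simp]: "list_det f [] [] = 1"
  by (simp add: list_det_def det_dim_zero)

lemma list_det_singleton [simp]: "list_det f [u] [v] = f u v"
  by (simp add: list_det_def det_single)

lemma list_det_cong:
  assumes "\<And>u v. u \<in> set rs \<Longrightarrow> v \<in> set cs \<Longrightarrow> f u v = g u v"
    and "length cs = length rs"
  shows "list_det f rs cs = list_det g rs cs"
  unfolding list_det_def by (intro arg_cong[where f = det] eq_matI) (auto simp: assms)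

text \<open>The same permutation acts on rows and on columns, so its sign enters twice and cancels.
  The columns are permuted as rows of the transpose.\<close>

lemma list_det_reorder:
  assumes "distinct vs" "distinct ws" "set vs = set ws"
  shows "list_det f vs vs = list_det f ws ws"
proof -
  define n where "n = length ws"
  have "mset vs = mset ws"
    using assms set_eq_iff_mset_eq_distinct by blast
  then obtain p where p: "p permutes {..<length ws}" "permute_list p ws = vs"
    by (rule mset_eq_permutation)
  have len: "length vs = n"
    using p n_def by auto
  have p': "p permutes {0..<n}"
    using p(1) by (simp add: n_def atLeast0LessThan)
  have nth: "vs ! i = ws ! p i" if "i < n" for i
    using permute_list_nth[OF p(1)] p(2) that n_def by auto
  have lt: "p i < n" if "i < n" for i
    using permutes_in_image[OF p'] that by auto
  define B where "B = mat n n (\<lambda>(i, j). f (ws ! i) (ws ! j))"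
  define C where "C = mat n n (\<lambda>(i, j). B $$ (p i, j))"
  have B: "B \<in> carrier_mat n n" and C: "C \<in> carrier_mat n n"
    by (auto simp: B_def C_def)
  have eq: "mat n n (\<lambda>(i, j). f (vs ! i) (vs ! j))
      = transpose_mat (mat n n (\<lambda>(i, j). transpose_mat C $$ (p i, j)))"
    by (intro eq_matI) (auto simp: C_def B_def nth lt)
  have "list_det f vs vs = det (mat n n (\<lambda>(i, j). f (vs ! i) (vs ! j)))"
    by (simp add: list_det_def len)
  also have "\<dots> = det (mat n n (\<lambda>(i, j). transpose_mat C $$ (p i, j)))"
    unfolding eq by (rule det_transpose) auto
  also have "\<dots> = signof p * det (transpose_mat C)"
    by (rule det_permute_rows) (use C p' in auto)
  also have "\<dots> = signof p * (signof p * det B)"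
    using det_transpose[OF C] det_permute_rows[OF B p'] by (simp add: C_def)
  also have "\<dots> = det B"
    by (simp flip: mult.assoc of_int_mult)
  finally show ?thesis
    by (simp add: B_def list_det_def n_def)
qed

lemma list_det_append:
  fixes f :: "'u \<Rightarrow> 'v \<Rightarrow> 'a :: idom"
  assumes "length cs = length rs" "length cs' = length rs'"
    and "\<And>u v. u \<in> set rs' \<Longrightarrow> v \<in> set cs \<Longrightarrow> f u v = 0"
  shows "list_det f (rs @ rs') (cs @ cs') = list_det f rs cs * list_det f rs' cs'"
proof -
  have "mat (length (rs @ rs')) (length (rs @ rs')) (\<lambda>(i, j). f ((rs @ rs') ! i) ((cs @ cs') ! j))
    = four_block_mat (mat (length rs) (length rs) (\<lambda>(i, j). f (rs ! i) (cs ! j)))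
       (mat (length rs) (length rs') (\<lambda>(i, j). f (rs ! i) (cs' ! j)))
       (0\<^sub>m (length rs') (length rs))
       (mat (length rs') (length rs') (\<lambda>(i, j). f (rs' ! i) (cs' ! j)))"
    by (intro eq_matI) (use assms in \<open>auto simp: nth_append\<close>)
  then have "list_det f (rs @ rs') (cs @ cs') = det (four_block_mat (mat (length rs) (length rs) (\<lambda>(i, j). f (rs ! i) (cs ! j)))
       (mat (length rs) (length rs') (\<lambda>(i, j). f (rs ! i) (cs' ! j)))
       (0\<^sub>m (length rs') (length rs))
       (mat (length rs') (length rs') (\<lambda>(i, j). f (rs' ! i) (cs' ! j))))"
    by (simp only: list_det_def)
  also have "\<dots> = list_det f rs cs * list_det f rs' cs'"
    unfolding list_det_def by (rule det_four_block_mat_lower_left_zero) auto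
  finally show ?thesis .
qed

lemma list_det_diagonal:
  fixes f :: "'u \<Rightarrow> 'u \<Rightarrow> 'a :: idom"
  assumes "distinct vs" and "\<And>u v. u \<in> set vs \<Longrightarrow> v \<in> set vs \<Longrightarrow> u \<noteq> v \<Longrightarrow> f u v = 0"
  shows "list_det f vs vs = (\<Prod>v\<leftarrow>vs. f v v)"
  using assms
proof (induction vs)
  case (Cons v vs)
  have "list_det f ([v] @ vs) ([v] @ vs) = list_det f [v] [v] * list_det f vs vs"
    by (rule list_det_append) (use Cons.prems in auto)
  then show ?case
    using Cons by simp
qed simp

lemma sum_nth_distinct:
  assumes "distinct vs"
  shows "(\<Sum>k = 0..<length vs. g (vs ! k)) = sum g (set vs)"
  using sum.reindex_bij_betw[OF bij_betw_nth[OF assms refl refl], of g]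
  by (simp add: atLeast0LessThan)

lemma list_det_mult:
  assumes "distinct vs"
  shows "list_det (\<lambda>u v. \<Sum>w\<in>set vs. f u w * g w v) vs vs = list_det f vs vs * list_det g vs vs"
proof -
  let ?n = "length vs"
  let ?M = "\<lambda>f. mat ?n ?n (\<lambda>(i, j). f (vs ! i) (vs ! j))"
  have "?M (\<lambda>u v. \<Sum>w\<in>set vs. f u w * g w v) = ?M f * ?M g"
    by (intro eq_matI) (auto simp: scalar_prod_def simp flip: sum_nth_distinct[OF assms])
  then show ?thesis
    by (simp add: list_det_def) (rule det_mult[of _ ?n]; simp)
qed

text \<open>Laplace expansion along the first row; deleting column \<open>j\<close> of the matrix is
  deleting position \<open>j\<close> of \<open>cs\<close>.\<close>

lemma list_det_expand_row:
  assumes "length cs = Suc (length rs)"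
  shows "list_det f (u # rs) cs
    = (\<Sum>j<length cs. (-1) ^ j * f u (cs ! j) * list_det f rs (take j cs @ drop (Suc j) cs))"
proof -
  let ?n = "length rs"
  let ?A = "mat (Suc ?n) (Suc ?n) (\<lambda>(i, j). f ((u # rs) ! i) (cs ! j))"
  have A: "?A \<in> carrier_mat (Suc ?n) (Suc ?n)"
    by simp
  have del: "mat_delete ?A 0 j
      = mat ?n ?n (\<lambda>(i, k). f (rs ! i) ((take j cs @ drop (Suc j) cs) ! k))" if "j < Suc ?n" for j
    by (intro eq_matI) (use that assms in \<open>auto simp: mat_delete_def nth_append\<close>)
  have "list_det f (u # rs) cs = (\<Sum>j<Suc ?n. ?A $$ (0, j) * cofactor ?A 0 j)"
    using laplace_expansion_row[OF A, of 0] by (simp add: list_det_def)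
  also have "\<dots> = (\<Sum>j<length cs. (-1) ^ j * f u (cs ! j)
      * list_det f rs (take j cs @ drop (Suc j) cs))"
    unfolding assms
    by (intro sum.cong refl) (simp add: cofactor_def del list_det_def algebra_simps)
  finally show ?thesis .
qed

text \<open>Expansion along row \<open>u\<close> leaves two terms. In the minor belonging to
  \<open>f u v\<close>, with rows \<open>v # ws\<close> and columns \<open>u # ws\<close>, column
  \<open>u\<close> vanishes below \<open>f v u\<close>, so this minor is block triangular. The
  off-diagonal entries thus enter only through the product \<open>f u v * f v u\<close>.\<close>

lemma list_det_tridiagonal:
  fixes f :: "'u \<Rightarrow> 'u \<Rightarrow> 'a :: idom"
  assumes "\<And>w. w \<in> set ws \<Longrightarrow> f u w = 0" "\<And>w. w \<in> set ws \<Longrightarrow> f w u = 0"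
  shows "list_det f (u # v # ws) (u # v # ws)
    = f u u * list_det f (v # ws) (v # ws) - f u v * f v u * list_det f ws ws"
proof -
  have "list_det f ([v] @ ws) ([u] @ ws) = list_det f [v] [u] * list_det f ws ws"
    by (rule list_det_append) (use assms in auto)
  then have "list_det f (v # ws) (u # ws) = f v u * list_det f ws ws"
    by simp
  moreover have "f u (ws ! j) = 0" if "j < length ws" for j
    using assms that by simp
  ultimately show ?thesis
    by (subst list_det_expand_row) (simp_all add: sum.lessThan_Suc_shift algebra_simps del: sum.lessThan_Suc)
qed

lemma list_det_transpose: "list_det (\<lambda>u v. f v u) vs vs = list_det f vs vs"
proof -
  let ?M = "mat (length vs) (length vs) (\<lambda>(i, j). f (vs ! i) (vs ! j))"
  have "mat (length vs) (length vs) (\<lambda>(i, j). f (vs ! j) (vs ! i)) = transpose_mat ?M"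
    by (intro eq_matI) auto
  then show ?thesis
    using det_transpose[of ?M "length vs"] by (simp add: list_det_def)
qed

text \<open>Off the diagonal, nonzero entries occur only in rows from \<open>B\<close> and columns
  outside \<open>B\<close>. Listing \<open>B\<close> first gives a block triangular matrix whose
  diagonal blocks are diagonal.\<close>

lemma list_det_triangular:
  fixes f :: "'u \<Rightarrow> 'u \<Rightarrow> 'a :: idom"
  assumes "distinct vs"
    and zero: "\<And>u v. u \<in> set vs \<Longrightarrow> v \<in> set vs \<Longrightarrow> u \<noteq> v \<Longrightarrow> u \<notin> B \<or> v \<in> B \<Longrightarrow> f u v = 0"
  shows "list_det f vs vs = (\<Prod>v\<in>set vs. f v v)"
proof -
  let ?bs = "filter (\<lambda>v. v \<in> B) vs" and ?cs = "filter (\<lambda>v. v \<notin> B) vs"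
  have "list_det f vs vs = list_det f (?bs @ ?cs) (?bs @ ?cs)"
    by (rule list_det_reorder) (use assms(1) in auto)
  also have "\<dots> = list_det f ?bs ?bs * list_det f ?cs ?cs"
    by (rule list_det_append) (use zero in auto)
  also have "\<dots> = (\<Prod>v\<leftarrow>?bs @ ?cs. f v v)"
    using list_det_diagonal[of ?bs f] list_det_diagonal[of ?cs f] assms(1) zero by auto
  also have "\<dots> = (\<Prod>v\<in>set (?bs @ ?cs). f v v)"
    by (rule prod.distinct_set_conv_list[symmetric]) (use assms(1) in auto)
  also have "set (?bs @ ?cs) = set vs"
    by auto
  finally show ?thesis .
qed

text \<open>All row operations are performed at once by left multiplication with \<open>q\<close>,
  the identity plus \<open>c\<close> at the positions \<open>(u, \<sigma> u)\<close> with
  \<open>u\<close> in \<open>B\<close>. As \<open>\<sigma>\<close> leads out of \<open>B\<close>,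
  \<open>q\<close> is triangular with unit diagonal.\<close>

lemma list_det_add_rows:
  fixes f :: "'u \<Rightarrow> 'u \<Rightarrow> 'a :: idom"
  assumes "distinct vs" "\<And>u. u \<in> B \<Longrightarrow> u \<in> set vs \<Longrightarrow> \<sigma> u \<in> set vs - B"
  shows "list_det (\<lambda>u v. f u v + (if u \<in> B then c * f (\<sigma> u) v else 0)) vs vs = list_det f vs vs"
proof -
  define q where "q u w = (if u = w then 1 else 0) + (if u \<in> B \<and> w = \<sigma> u then c else 0)" for u w
  have "list_det q vs vs = (\<Prod>v\<in>set vs. q v v)"
    by (rule list_det_triangular[where B = B]) (use assms in \<open>auto simp: q_def\<close>)
  also have "\<dots> = 1"
    by (rule prod.neutral) (use assms(2) in \<open>force simp: q_def\<close>)
  finally have q: "list_det q vs vs = 1" .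
  have sum: "(\<Sum>w\<in>set vs. q u w * f w v) = f u v + (if u \<in> B then c * f (\<sigma> u) v else 0)"
    if "u \<in> set vs" for u v
  proof -
    have "q u w * f w v
        = (if u = w then f w v else 0) + (if w = \<sigma> u then (if u \<in> B then c * f w v else 0) else 0)" for w
      by (simp add: q_def distrib_right)
    then show ?thesis
      using that assms(2)[of u] by (auto simp: sum.distrib)
  qed
  have "list_det (\<lambda>u v. f u v + (if u \<in> B then c * f (\<sigma> u) v else 0)) vs vs
      = list_det (\<lambda>u v. \<Sum>w\<in>set vs. q u w * f w v) vs vs"
    by (rule list_det_cong) (simp_all only: sum)
  then show ?thesis
    by (simp add: list_det_mult[OF assms(1)] q)
qed

lemma list_det_add_cols:
  fixes f :: "'u \<Rightarrow> 'u \<Rightarrow> 'a :: idom"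
  assumes "distinct vs" "\<And>v. v \<in> B \<Longrightarrow> v \<in> set vs \<Longrightarrow> \<sigma> v \<in> set vs - B"
  shows "list_det (\<lambda>u v. f u v + (if v \<in> B then c * f u (\<sigma> v) else 0)) vs vs = list_det f vs vs"
  using list_det_add_rows[OF assms, where f = "\<lambda>u v. f v u" and c = c]
    list_det_transpose[of "\<lambda>u v. f u v + (if v \<in> B then c * f u (\<sigma> v) else 0)" vs]
    list_det_transpose[of f vs]
  by simp

section \<open>Tridiagonal determinants and the polynomials \<open>U\<close>\<close>

text \<open>Expansion at the first label is the recurrence for \<open>U\<close>. Prescribing only
  products of opposite off-diagonal entries also admits matrices that are not symmetric.\<close>

lemma list_det_path:
  assumes "\<And>i. l \<le> i \<Longrightarrow> i < l + n \<Longrightarrow> f i i = monom 1 2 - of_nat a"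
    and "\<And>i. l \<le> i \<Longrightarrow> Suc i < l + n \<Longrightarrow> f i (Suc i) * f (Suc i) i = monom 1 2"
    and "\<And>i j. l \<le> i \<Longrightarrow> Suc i < j \<Longrightarrow> j < l + n \<Longrightarrow> f i j = 0 \<and> f j i = 0"
  shows "list_det f [l..<l + n] [l..<l + n] = U a n"
  using assms
proof (induction a n arbitrary: l rule: U.induct)
  case (3 a j)
  have split: "[l..<l + Suc (Suc j)] = l # Suc l # [Suc (Suc l)..<l + Suc (Suc j)]"
    by (simp add: upt_conv_Cons del: upt_Suc)
  have "list_det f [l..<l + Suc (Suc j)] [l..<l + Suc (Suc j)]
    = f l l * list_det f [Suc l..<Suc l + Suc j] [Suc l..<Suc l + Suc j]
      - f l (Suc l) * f (Suc l) l * list_det f [Suc (Suc l)..<Suc (Suc l) + j] [Suc (Suc l)..<Suc (Suc l) + j]"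
    unfolding split by (subst list_det_tridiagonal) (use "3.prems"(3) in \<open>auto simp: upt_conv_Cons simp del: upt_Suc\<close>)
  also have "list_det f [Suc l..<Suc l + Suc j] [Suc l..<Suc l + Suc j] = U a (Suc j)"
    by (rule "3.IH"(1)) (use "3.prems" in auto)
  also have "list_det f [Suc (Suc l)..<Suc (Suc l) + j] [Suc (Suc l)..<Suc (Suc l) + j] = U a j"
    by (rule "3.IH"(2)) (use "3.prems" in auto)
  finally show ?case
    using "3.prems"(1)[of l] "3.prems"(2)[of l] by simp
next
  case (2 a)
  then show ?case
    by (simp add: upt_rec)
qed simp

text \<open>There are \<open>n + 1\<close> regular labels, followed by one with diagonal entry
  \<open>d\<close> and coupling product \<open>e\<close>. The formula is the expansion at that last
  label. Since \<open>list_det_tridiagonal\<close> splits at the front, the proof instead checks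
  that both sides satisfy the recurrence for \<open>U\<close> in \<open>n\<close>.\<close>

lemma list_det_path_end:
  assumes "\<And>i. l \<le> i \<Longrightarrow> i \<le> l + n \<Longrightarrow> f i i = monom 1 2 - of_nat a"
    and "\<And>i. l \<le> i \<Longrightarrow> i < l + n \<Longrightarrow> f i (Suc i) * f (Suc i) i = monom 1 2"
    and "\<And>i j. l \<le> i \<Longrightarrow> Suc i < j \<Longrightarrow> j \<le> Suc (l + n) \<Longrightarrow> f i j = 0 \<and> f j i = 0"
    and "f (Suc (l + n)) (Suc (l + n)) = d"
    and "f (l + n) (Suc (l + n)) * f (Suc (l + n)) (l + n) = e"
  shows "list_det f [l..<Suc (Suc (l + n))] [l..<Suc (Suc (l + n))] = d * U a (Suc n) - e * U a n"
  using assms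
proof (induction a n arbitrary: l rule: U.induct)
  case (1 a)
  have "[l..<Suc (Suc (l + 0))] = [l, Suc l]"
    by (simp add: upt_rec)
  then show ?case
    using "1.prems"(1)[of l] "1.prems"(4,5)
    using list_det_tridiagonal[of "[]" f l "Suc l"] by (simp add: mult.commute)
next
  case (2 a)
  let ?x = "monom 1 2 - of_nat a :: real poly"
  have "[l..<Suc (Suc (l + Suc 0))] = [l, Suc l, Suc (Suc l)]"
    by (simp add: upt_rec)
  moreover have "list_det f [l, Suc l, Suc (Suc l)] [l, Suc l, Suc (Suc l)] = ?x * (?x * d - e) - monom 1 2 * d"
    using "2.prems"(1)[of l] "2.prems"(1)[of "Suc l"] "2.prems"(2)[of l]
      "2.prems"(3)[of l "Suc (Suc l)"] "2.prems"(4,5)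
      list_det_tridiagonal[of "[]" f "Suc l" "Suc (Suc l)"]
      list_det_tridiagonal[of "[Suc (Suc l)]" f l "Suc l"]
    by simp
  ultimately show ?case
    by (simp add: algebra_simps)
next
  case (3 a j)
  have split: "[l..<Suc (Suc (l + Suc (Suc j)))] = l # Suc l # [Suc (Suc l)..<Suc (Suc (l + Suc (Suc j)))]"
    by (simp add: upt_conv_Cons del: upt_Suc)
  have "list_det f [l..<Suc (Suc (l + Suc (Suc j)))] [l..<Suc (Suc (l + Suc (Suc j)))]
    = f l l * list_det f [Suc l..<Suc (Suc (Suc l + Suc j))] [Suc l..<Suc (Suc (Suc l + Suc j))]
      - f l (Suc l) * f (Suc l) l
        * list_det f [Suc (Suc l)..<Suc (Suc (Suc (Suc l) + j))] [Suc (Suc l)..<Suc (Suc (Suc (Suc l) + j))]"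
    unfolding split by (subst list_det_tridiagonal) (use "3.prems"(3) in \<open>auto simp: upt_conv_Cons simp del: upt_Suc\<close>)
  also have "list_det f [Suc l..<Suc (Suc (Suc l + Suc j))] [Suc l..<Suc (Suc (Suc l + Suc j))]
      = d * U a (Suc (Suc j)) - e * U a (Suc j)"
    by (rule "3.IH"(1)) (use "3.prems" in auto)
  also have "list_det f [Suc (Suc l)..<Suc (Suc (Suc (Suc l) + j))] [Suc (Suc l)..<Suc (Suc (Suc (Suc l) + j))]
      = d * U a (Suc j) - e * U a j"
    by (rule "3.IH"(2)) (use "3.prems" in auto)
  finally show ?case
    using "3.prems"(1)[of l] "3.prems"(2)[of l] by (simp add: algebra_simps)
qed

section \<open>Elimination of the pendant vertices\<close>

lemma char_poly_adjacency_matrix: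
  assumes "distinct vs"
  shows "char_poly (adjacency_matrix G vs) = list_det
    (\<lambda>u v. (if u = v then monom 1 1 else 0) - (if (u, v) \<in> parcs G then 1 else 0)) vs vs"
  unfolding char_poly_def list_det_def
  by (intro arg_cong[where f = det] eq_matI)
    (use assms in \<open>auto simp: char_poly_matrix_def adjacency_matrix_def nth_eq_iff_index_eq
      monom_altdef one_pCons\<close>)

lemma pverts_attach_pendants:
  "pverts (attach_pendants G c) = Inl ` pverts G \<union> Inr ` (SIGMA v:pverts G. {..<c v})"
  by (auto simp: attach_pendants_def)

text \<open>A Schur complement without denominators. The product \<open>MN\<close> is block
  triangular: the old vertices carry the matrix on the right, the pendants carry \<open>X\<close>
  times the identity. The factor \<open>monom 1 (length us)\<close> on the left is the determinant
  of \<open>N\<close>.\<close>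

lemma char_poly_attach_pendants:
  fixes G :: "'a pair_pre_digraph"
  assumes "distinct vs" "set vs = pverts (attach_pendants G c)"
    and "distinct us" "set us = pverts G"
  shows "monom 1 (length us) * char_poly (adjacency_matrix (attach_pendants G c) vs)
    = monom 1 (\<Sum>v\<in>pverts G. c v) * list_det (\<lambda>u v.
        (if u = v then monom 1 2 - of_nat (c v) else 0)
        - (if (u, v) \<in> parcs G then monom 1 1 else 0)) us us"
proof -
  let ?X = "monom 1 1 :: real poly"
  let ?P = "SIGMA v:pverts G. {..<c v}"
  define M where "M = (\<lambda>u v. (if u = v then ?X else 0)
    - (if (u, v) \<in> parcs (attach_pendants G c) then 1 else 0))"
  \<comment> \<open>Multiplying \<open>M\<close> by \<open>N\<close> clears the pendant-cycle block without dividing by \<open>X\<close>.\<close>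
  define N :: "'a + 'a \<times> nat \<Rightarrow> 'a + 'a \<times> nat \<Rightarrow> real poly"
    where "N = (\<lambda>u v. case u of
      Inl i \<Rightarrow> (if v = Inl i then ?X else 0)
    | Inr p \<Rightarrow> (if v = Inr p \<or> v = Inl (fst p) then 1 else 0))"
  define MN where "MN u v = (\<Sum>w\<in>set vs. M u w * N w v)" for u v
  have fin: "finite (pverts G)"
    using assms(4) by (metis List.finite_set)
  have finP: "finite ?P"
    using fin by auto
  obtain ps where ps: "set ps = ?P" "distinct ps"
    using finite_distinct_list[OF finP] by blast
  have sum: "sum g (set vs) = (\<Sum>i\<in>pverts G. g (Inl i)) + (\<Sum>p\<in>?P. g (Inr p))" for g :: "_ \<Rightarrow> real poly"
    unfolding assms(2) pverts_attach_pendants using fin finP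
    by (subst sum.union_disjoint) (auto simp: sum.reindex)
  have prod: "prod g (set vs) = (\<Prod>i\<in>pverts G. g (Inl i)) * (\<Prod>p\<in>?P. g (Inr p))" for g :: "_ \<Rightarrow> real poly"
    unfolding assms(2) pverts_attach_pendants using fin finP
    by (subst prod.union_disjoint) (auto simp: prod.reindex)
  have card: "card (pverts G) = length us" "card ?P = (\<Sum>v\<in>pverts G. c v)"
    using assms(3,4) fin by (auto simp: distinct_card simp flip: assms(4))
  have M_Inl: "M (Inl i) (Inl j) = (if i = j then ?X else 0) - (if (i, j) \<in> parcs G then 1 else 0)" for i j
    by (auto simp: M_def attach_pendants_def)
  have M_Inl_Inr: "M (Inl i) (Inr p) = (if fst p = i then -1 else 0)" if "p \<in> ?P" for i p
    using that by (auto simp: M_def attach_pendants_def)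
  have M_Inr_Inl: "M (Inr p) (Inl i) = (if i = fst p then -1 else 0)" if "p \<in> ?P" for i p
    using that by (auto simp: M_def attach_pendants_def)
  have M_Inr: "M (Inr p) (Inr q) = (if q = p then ?X else 0)" for p q
    by (auto simp: M_def attach_pendants_def)
  have "list_det N vs vs = (\<Prod>v\<in>set vs. N v v)"
    by (rule list_det_triangular[where B = "range Inr"])
      (use assms(1) in \<open>auto simp: N_def split: sum.splits\<close>)
  then have N: "list_det N vs vs = monom 1 (length us)"
    by (simp add: prod N_def card monom_power)
  have MN_Inl: "MN (Inl i) (Inl j)
      = (if i = j then monom 1 2 - of_nat (c j) else 0) - (if (i, j) \<in> parcs G then ?X else 0)"
    if "i \<in> pverts G" "j \<in> pverts G" for i j
  proof -
    \<comment> \<open>Each of the \<open>c i\<close> pendants at \<open>i\<close> contributes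
      \<open>-1\<close>, and only on the diagonal.\<close>
    have "(\<Sum>p\<in>?P. M (Inl i) (Inr p) * N (Inr p) (Inl j))
        = (\<Sum>p\<in>?P. if fst p = i then (if i = j then -1 else 0) else 0)"
      by (intro sum.cong refl) (auto simp: M_Inl_Inr N_def)
    also have "\<dots> = (\<Sum>v\<in>pverts G. \<Sum>k<c v. if v = i then (if i = j then -1 else 0) else 0)"
      using fin by (subst sum.Sigma) (auto simp: case_prod_beta)
    also have "\<dots> = (\<Sum>v\<in>pverts G. if v = i then of_nat (c v) * (if i = j then -1 else 0) else 0)"
      by (intro sum.cong refl) auto
    also have "\<dots> = (if i = j then - of_nat (c j) else 0)"
      using fin that by simp
    finally have "(\<Sum>p\<in>?P. M (Inl i) (Inr p) * N (Inr p) (Inl j)) = (if i = j then - of_nat (c j) else 0)" .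
    moreover have "(\<Sum>k\<in>pverts G. M (Inl i) (Inl k) * N (Inl k) (Inl j)) = M (Inl i) (Inl j) * ?X"
    proof -
      have "(\<Sum>k\<in>pverts G. M (Inl i) (Inl k) * N (Inl k) (Inl j))
          = (\<Sum>k\<in>pverts G. if j = k then M (Inl i) (Inl k) * ?X else 0)"
        by (intro sum.cong refl) (auto simp: N_def)
      then show ?thesis
        using fin that by simp
    qed
    ultimately show ?thesis
      by (auto simp: MN_def sum M_Inl mult_monom algebra_simps numeral_2_eq_2)
  qed
  have MN_Inr: "MN (Inr p) v = (if v = Inr p then ?X else 0)"
    if "p \<in> ?P" "v \<in> set vs" for p v
  proof -
    have "fst p \<in> pverts G"
      using that by auto
    have "(\<Sum>k\<in>pverts G. M (Inr p) (Inl k) * N (Inl k) v)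
        = (\<Sum>k\<in>pverts G. if k = fst p then - N (Inl k) v else 0)"
      using that by (intro sum.cong refl) (auto simp: M_Inr_Inl)
    also have "\<dots> = - N (Inl (fst p)) v"
      using fin \<open>fst p \<in> pverts G\<close> by simp
    finally have 1: "(\<Sum>k\<in>pverts G. M (Inr p) (Inl k) * N (Inl k) v) = - N (Inl (fst p)) v" .
    have "(\<Sum>q\<in>?P. M (Inr p) (Inr q) * N (Inr q) v)
        = (\<Sum>q\<in>?P. if q = p then ?X * N (Inr q) v else 0)"
      by (intro sum.cong refl) (auto simp: M_Inr)
    also have "\<dots> = ?X * N (Inr p) v"
      using finP that by simp
    finally have "MN (Inr p) v = - N (Inl (fst p)) v + ?X * N (Inr p) v"
      by (simp only: MN_def sum 1)
    \<comment> \<open>At \<open>v = Inl (fst p)\<close> the two terms are \<open>- X\<close> and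
      \<open>X\<close> and cancel; this is the purpose of the entries of \<open>N\<close> between a
      pendant and its neighbour.\<close>
    then show ?thesis
      by (auto simp: N_def)
  qed
  have "char_poly (adjacency_matrix (attach_pendants G c) vs) * monom 1 (length us)
      = list_det M vs vs * list_det N vs vs"
    by (simp add: char_poly_adjacency_matrix[OF assms(1)] M_def N)
  also have "\<dots> = list_det MN vs vs"
    unfolding MN_def by (rule list_det_mult[OF assms(1), symmetric])
  also have "\<dots> = list_det MN (map Inl us @ map Inr ps) (map Inl us @ map Inr ps)"
    by (rule list_det_reorder)
      (use assms ps in \<open>auto simp: distinct_map pverts_attach_pendants\<close>)
  also have "\<dots> = list_det MN (map Inl us) (map Inl us) * list_det MN (map Inr ps) (map Inr ps)"
    by (rule list_det_append)
      (use assms ps MN_Inr in \<open>auto simp: pverts_attach_pendants\<close>)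
  also have "list_det MN (map Inr ps) (map Inr ps) = (\<Prod>v\<leftarrow>map Inr ps. MN v v)"
    by (rule list_det_diagonal)
      (use assms ps MN_Inr in \<open>auto simp: pverts_attach_pendants distinct_map\<close>)
  also have "\<dots> = (\<Prod>p\<in>?P. MN (Inr p) (Inr p))"
    using ps by (simp add: prod.distinct_set_conv_list comp_def flip: ps(1))
  also have "\<dots> = (\<Prod>p\<in>?P. ?X)"
    by (rule prod.cong) (auto simp: MN_Inr assms(2) pverts_attach_pendants)
  also have "\<dots> = monom 1 (\<Sum>v\<in>pverts G. c v)"
    by (simp add: card monom_power del: card_SigmaI)
  also have "list_det MN (map Inl us) (map Inl us) = list_det (\<lambda>u v. MN (Inl u) (Inl v)) us us"
    unfolding list_det_def by (intro arg_cong[where f = det] eq_matI) auto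
  also have "\<dots> = list_det (\<lambda>u v. (if u = v then monom 1 2 - of_nat (c v) else 0)
        - (if (u, v) \<in> parcs G then ?X else 0)) us us"
    by (rule list_det_cong) (use assms(4) MN_Inl in auto)
  finally show ?thesis
    by (simp add: mult.commute)
qed

section \<open>Splitting the cyclic matrix by the reflection\<close>

text \<open>Removes \<open>mod\<close>, so that entries of the cyclic matrix can be decided by
  linear arithmetic on the labels.\<close>

lemma arcs_cycle_graph:
  assumes "i \<in> {1..m}" "j \<in> {1..m}" "m \<ge> 3"
  shows "(i, j) \<in> parcs (cycle_graph m)
    \<longleftrightarrow> j = Suc i \<or> i = Suc j \<or> (i = 1 \<and> j = m) \<or> (i = m \<and> j = 1)"
proof -
  have "k mod m + 1 = (if k = m then 1 else Suc k)" if "k \<in> {1..m}" for k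
    using that by auto
  then show ?thesis
    using assms by (auto simp: cycle_graph_def)
qed

text \<open>In the conjugated matrix the labels \<open>1\<close> to \<open>h + 1\<close> carry the
  symmetric part and the labels \<open>h + 2\<close> to \<open>2 * h\<close> the antisymmetric part;
  the block below the diagonal vanishes.\<close>

lemma list_det_cycle:
  fixes h a :: nat
  defines "x \<equiv> monom 1 2 - of_nat a"
  defines "f \<equiv> (\<lambda>i j. (if i = j then (if i = 1 then monom 1 2
        else if i = h + 1 then monom 1 2 - of_nat (2 * a) else x) else 0)
      - (if (i, j) \<in> parcs (cycle_graph (2 * h)) then monom 1 1 else 0))"
  assumes "h \<ge> 2"
  shows "list_det f [1..<Suc (2 * h)] [1..<Suc (2 * h)]
    = monom 1 2 * (monom 1 2 - of_nat (2 * a) - 4) * (U a (h - 1))\<^sup>2"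
proof -
  let ?vs = "[1..<Suc (2 * h)]"
  let ?X2 = "monom 1 2 :: real poly"
  let ?s = "monom 1 (Suc 0) :: real poly"
  \<comment> \<open>On \<open>{2..2 * h}\<close> this is the reflection; it fixes
    \<open>h + 1\<close> and exchanges \<open>L\<close> and \<open>R\<close>. The fixed vertex
    \<open>1\<close> is not covered by the formula, which sends it to \<open>2 * h + 1\<close>, and
    is treated separately in \<open>f_reflect1\<close>.\<close>
  define \<sigma> where "\<sigma> i = 2 * h + 2 - i" for i
  define L where "L = {2..h}"
  define R where "R = {h + 2..2 * h}"
  \<comment> \<open>Adding column \<open>\<sigma> j\<close> to column \<open>j\<close> and then subtracting row \<open>\<sigma> i\<close> from row \<open>i\<close> is a
    conjugation that splits off the part antisymmetric under \<open>\<sigma>\<close>.\<close>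
  define g where "g = (\<lambda>i j. f i j + (if j \<in> L then 1 * f i (\<sigma> j) else 0))"
  define k where "k = (\<lambda>i j. g i j + (if i \<in> R then (-1) * g (\<sigma> i) j else 0))"
  have f: "f i j = (if i = j then (if i = 1 then ?X2 else if i = h + 1 then ?X2 - of_nat (2 * a) else x) else 0)
      - (if j = Suc i \<or> i = Suc j \<or> (i = 1 \<and> j = 2 * h) \<or> (i = 2 * h \<and> j = 1) then ?s else 0)"
    if "1 \<le> i" "i \<le> 2 * h" "1 \<le> j" "j \<le> 2 * h" for i j
    using arcs_cycle_graph[of i "2 * h" j] that \<open>h \<ge> 2\<close> by (simp add: f_def)
  have ss: "?s * ?s = ?X2"
    by (simp add: mult_monom numeral_2_eq_2)
  have f_reflect: "f (\<sigma> i) (\<sigma> j) = f i j" if "i \<in> {2..2 * h}" "j \<in> {2..2 * h}" for i j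
  proof -
    have "\<sigma> i = \<sigma> j \<longleftrightarrow> i = j" "\<sigma> i = h + 1 \<longleftrightarrow> i = h + 1" "\<sigma> i \<noteq> 1" "\<sigma> j \<noteq> 1"
      "\<sigma> j = Suc (\<sigma> i) \<longleftrightarrow> i = Suc j" "\<sigma> i = Suc (\<sigma> j) \<longleftrightarrow> j = Suc i"
      "1 \<le> \<sigma> i" "\<sigma> i \<le> 2 * h" "1 \<le> \<sigma> j" "\<sigma> j \<le> 2 * h"
      using that by (auto simp: \<sigma>_def)
    then show ?thesis
      using that by (auto simp: f)
  qed
  have f_reflect1: "f (\<sigma> i) 1 = f i 1" if "i \<in> {2..2 * h}" for i
  proof -
    have "\<sigma> i = 2 \<longleftrightarrow> i = 2 * h" "\<sigma> i = 2 * h \<longleftrightarrow> i = 2" "\<sigma> i \<noteq> 1" "\<sigma> i \<noteq> 0"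
      "1 \<le> \<sigma> i" "\<sigma> i \<le> 2 * h"
      using that by (auto simp: \<sigma>_def)
    then show ?thesis
      using that \<open>h \<ge> 2\<close> by (auto simp: f numeral_2_eq_2)
  qed
  have vs_split: "?vs = [1..<h + 2] @ [h + 2..<Suc (2 * h)]"
    using \<open>h \<ge> 2\<close> upt_add_eq_append[of 1 "h + 2" "h - 1"] by (simp add: mult_2 del: upt_Suc)
  have "list_det f ?vs ?vs = list_det g ?vs ?vs"
    unfolding g_def
    by (rule list_det_add_cols[symmetric]) (auto simp: L_def \<sigma>_def)
  also have "\<dots> = list_det k ?vs ?vs"
    unfolding k_def
    by (rule list_det_add_rows[symmetric]) (auto simp: R_def \<sigma>_def)
  also have "list_det k ?vs ?vs
      = list_det k [1..<h + 2] [1..<h + 2] * list_det k [h + 2..<Suc (2 * h)] [h + 2..<Suc (2 * h)]"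
    unfolding vs_split
  proof (rule list_det_append)
    fix i j assume ij: "i \<in> set [h + 2..<Suc (2 * h)]" "j \<in> set [1..<h + 2]"
    have R: "i \<in> R"
      using ij by (auto simp: R_def)
    have k: "k i j = f i j + (if j \<in> L then f i (\<sigma> j) else 0)
        - (f (\<sigma> i) j + (if j \<in> L then f (\<sigma> i) (\<sigma> j) else 0))"
      using R by (simp add: k_def g_def)
    \<comment> \<open>Columns \<open>1\<close> and \<open>h + 1\<close> of \<open>g\<close> belong
      to fixed vertices, and those in \<open>L\<close> are sums over a reflected pair. In all of
      them rows \<open>i\<close> and \<open>\<sigma> i\<close> of \<open>g\<close> agree, so their
      difference is zero.\<close>
    consider "j = 1" | "j = h + 1" | "j \<in> L"
      using ij by (force simp: L_def)
    then show "k i j = 0"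
    proof cases
      case 1
      then show ?thesis
        unfolding k using f_reflect1[of i] R by (simp add: L_def R_def)
    next
      case 2
      then show ?thesis
        unfolding k using f_reflect[of i j] R by (simp add: L_def R_def \<sigma>_def)
    next
      case 3
      then have "\<sigma> j \<in> {2..2 * h}" "\<sigma> (\<sigma> j) = j"
        by (auto simp: L_def \<sigma>_def)
      then show ?thesis
        using f_reflect[of i j] f_reflect[of i "\<sigma> j"] R 3 by (simp add: k L_def R_def)
    qed
  qed auto
  also have "list_det k [h + 2..<Suc (2 * h)] [h + 2..<Suc (2 * h)] = U a (h - 1)"
  proof -
    have k: "k i j = f i j" if "i \<in> R" "j \<in> R" for i j
    proof -
      \<comment> \<open>The vertices \<open>1\<close> and \<open>h + 1\<close> separate
        \<open>L\<close> from \<open>R\<close>, so no edge joins \<open>\<sigma> i\<close> to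
        \<open>j\<close>.\<close>
      have "f (\<sigma> i) j = 0" "j \<notin> L"
        using that by (auto simp: f R_def L_def \<sigma>_def)
      then show ?thesis
        using that by (simp add: k_def g_def)
    qed
    have "list_det k [h + 2..<h + 2 + (h - 1)] [h + 2..<h + 2 + (h - 1)] = U a (h - 1)"
      by (rule list_det_path) (auto simp: k R_def f x_def ss)
    then show ?thesis
      using \<open>h \<ge> 2\<close> by (simp add: mult_2 del: upt_Suc)
  qed
  also have "list_det k [1..<h + 2] [1..<h + 2]
      = ?X2 * (?X2 - of_nat (2 * a) - 4) * U a (h - 1)"
  proof -
    have k: "k i j = f i j + (if j \<in> L then f i (\<sigma> j) else 0)" if "i \<le> h + 1" for i j
      using that by (auto simp: k_def g_def R_def)
    \<comment> \<open>Column \<open>2\<close> also collects column \<open>2 * h\<close>, and both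
      labels are neighbours of \<open>1\<close>. Hence \<open>k 1 2\<close> is
      \<open>- 2 * ?s\<close>, whereas \<open>k 2 1\<close> stays \<open>- ?s\<close>.\<close>
    have k11: "k 1 1 = ?X2" and k12: "k 1 2 * k 2 1 = 2 * ?X2"
      using \<open>h \<ge> 2\<close> by (auto simp: k f L_def \<sigma>_def algebra_simps simp flip: ss)
    have diag: "k i i = x" if "2 \<le> i" "i \<le> h" for i
      using that by (auto simp: k f L_def \<sigma>_def)
    have off: "k i (Suc i) * k (Suc i) i = ?X2" if "2 \<le> i" "i < h" for i
      using that by (auto simp: k f L_def \<sigma>_def ss)
    have zero: "k i j = 0 \<and> k j i = 0" if "1 \<le> i" "Suc i < j" "j \<le> h + 1" for i j
    proof -
      \<comment> \<open>The last condition excludes the closing edge. Below, \<open>p = 1\<close>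
        meets only \<open>j\<close> or \<open>\<sigma> j\<close> with \<open>2 < j\<close> and
        \<open>j \<le> h + 1\<close>, both smaller than \<open>2 * h\<close>.\<close>
      have f0: "f p q = 0 \<and> f q p = 0" if "1 \<le> p" "Suc p < q" "q \<le> 2 * h" "p \<noteq> 1 \<or> q \<noteq> 2 * h" for p q
        using that by (auto simp: f)
      have "f i (\<sigma> j) = 0"
        using that by (intro conjunct1[OF f0]) (auto simp: \<sigma>_def)
      moreover have "f j (\<sigma> i) = 0" if "i \<in> L"
        using that \<open>Suc i < j\<close> \<open>j \<le> h + 1\<close> by (intro conjunct1[OF f0]) (auto simp: L_def \<sigma>_def)
      moreover have "f i j = 0 \<and> f j i = 0"
        using that \<open>h \<ge> 2\<close> by (intro f0) auto
      ultimately show ?thesis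
        using that by (simp add: k)
    qed
    have last: "k (h + 1) (h + 1) = ?X2 - of_nat (2 * a)"
      using \<open>h \<ge> 2\<close> by (auto simp: k f L_def \<sigma>_def)
    \<comment> \<open>The doubling is now in row \<open>h + 1\<close>: its neighbours
      \<open>h\<close> and \<open>h + 2 = \<sigma> h\<close> are merged in column
      \<open>h\<close>.\<close>
    have last': "k h (h + 1) * k (h + 1) h = 2 * ?X2"
      using \<open>h \<ge> 2\<close> by (auto simp: k f L_def \<sigma>_def algebra_simps simp flip: ss)
    define d where "d = ?X2 - of_nat (2 * a)"
    \<comment> \<open>The regular labels \<open>l\<close> to \<open>h\<close> number
      \<open>h + 1 - l\<close>; the label \<open>h + 1\<close> is the exceptional end.\<close>
    have tail: "list_det k [l..<h + 2] [l..<h + 2] = d * U a (h + 1 - l) - 2 * ?X2 * U a (h - l)"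
      if "2 \<le> l" "l \<le> h" for l
    proof -
      obtain n where n: "h = l + n"
        using \<open>l \<le> h\<close> le_Suc_ex by blast
      have "list_det k [l..<Suc (Suc (l + n))] [l..<Suc (Suc (l + n))]
          = d * U a (Suc n) - 2 * ?X2 * U a n"
        by (rule list_det_path_end)
          (use that n diag off zero last last' in \<open>auto simp: x_def d_def\<close>)
      then show ?thesis
        using n by (simp add: Suc_diff_le)
    qed
    have split: "[1..<h + 2] = 1 # 2 # [3..<h + 2]" "[2..<h + 2] = 2 # [3..<h + 2]"
      using \<open>h \<ge> 2\<close> by (simp_all add: upt_conv_Cons numeral_2_eq_2 numeral_3_eq_3 del: upt_Suc)
    have "list_det k [1..<h + 2] [1..<h + 2]
        = ?X2 * list_det k [2..<h + 2] [2..<h + 2] - 2 * ?X2 * list_det k [3..<h + 2] [3..<h + 2]"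
      unfolding split
      by (subst list_det_tridiagonal) (use zero[of 1] in \<open>auto simp: k11[unfolded One_nat_def] k12[unfolded One_nat_def]\<close>)
    \<comment> \<open>The choice of no pendants at \<open>1\<close> and \<open>2 * a\<close> at
      \<open>h + 1\<close> gives \<open>?X2 + d = 2 * x\<close>. By the recurrence, all terms apart
      from \<open>d * U a (h - 1)\<close> then combine to \<open>- 4 * U a (h - 1)\<close>. For
      \<open>h = 2\<close> the shorter tail has no regular label left and is just
      \<open>d\<close>.\<close>
    also have "\<dots> = ?X2 * (d - 4) * U a (h - 1)"
    proof (cases "h = 2")
      case True
      then have "list_det k [3..<h + 2] [3..<h + 2] = d"
        using last by (simp add: d_def)
      show ?thesis
        unfolding \<open>list_det k [3..<h + 2] [3..<h + 2] = d\<close> tail[OF order.refl \<open>h \<ge> 2\<close>]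
        by (simp add: \<open>h = 2\<close> d_def algebra_simps)
    next
      case False
      then have "3 \<le> h"
        using \<open>h \<ge> 2\<close> by simp
      then obtain m where m: "h = 3 + m"
        using le_Suc_ex by blast
      have last_tail: "list_det k [3..<h + 2] [3..<h + 2] = d * U a (h + 1 - 3) - 2 * ?X2 * U a (h - 3)"
        by (rule tail) (use \<open>3 \<le> h\<close> in auto)
      show ?thesis
        unfolding last_tail tail[OF order.refl \<open>h \<ge> 2\<close>]
        by (simp add: m numeral_3_eq_3 d_def algebra_simps)
    qed
    finally show ?thesis
      by (simp add: d_def)
  qed
  finally show ?thesis
    by (simp add: power2_eq_square mult.assoc)
qed

section \<open>Counting vertices and cancelling the power of \<open>X\<close>\<close>

theorem theorem3p10:
  fixes h a n :: nat and vs :: "(nat + nat \<times> nat) list"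
  assumes "h \<ge> 2" and "a \<ge> 1"
    and "n = 2 * h * (a + 1)"
    and "distinct vs" and "set vs = pverts (S_graph h a)"
  shows "card (pverts (S_graph h a)) = n
    \<and> char_poly (adjacency_matrix (S_graph h a) vs) =
        monom 1 (2 * h * (a - 1) + 2) * (monom 1 2 - of_nat (2 * a) - 4) * (U a (h - 1))\<^sup>2"
proof
  define c where "c = (\<lambda>i. if i = 1 then 0 else if i = h + 1 then 2 * a else a)"
  have S: "S_graph h a = attach_pendants (cycle_graph (2 * h)) c"
    by (simp add: S_graph_def c_def)
  have verts: "pverts (cycle_graph (2 * h)) = {1..2 * h}"
    by (simp add: cycle_graph_def)
  \<comment> \<open>The surplus of \<open>a\<close> pendants at \<open>h + 1\<close> makes up for
    the missing ones at \<open>1\<close>, so the average is \<open>a\<close> per cycle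
    vertex.\<close>
  have "(\<Sum>i = 1..2 * h. c i) = c 1 + (c (h + 1) + (\<Sum>i\<in>{1..2 * h} - {1} - {h + 1}. c i))"
    using \<open>h \<ge> 2\<close> by (subst sum.remove[of _ 1], simp, simp, subst sum.remove[of _ "h + 1"]) auto
  also have "(\<Sum>i\<in>{1..2 * h} - {1} - {h + 1}. c i) = (\<Sum>i\<in>{1..2 * h} - {1} - {h + 1}. a)"
    by (rule sum.cong) (auto simp: c_def)
  also have "\<dots> = (2 * h - 2) * a"
    using \<open>h \<ge> 2\<close> by (simp add: card_Diff_subset numeral_2_eq_2)
  also have "c 1 + (c (h + 1) + (2 * h - 2) * a) = 2 * h * a"
    using \<open>h \<ge> 2\<close> by (simp add: c_def algebra_simps flip: add_mult_distrib)
  finally have sum_c: "(\<Sum>i = 1..2 * h. c i) = 2 * h * a" .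
  show "card (pverts (S_graph h a)) = n"
    unfolding S pverts_attach_pendants verts
    by (subst card_Un_disjoint) (auto simp: card_image sum_c[unfolded One_nat_def] \<open>n = _\<close>)
  have "monom 1 (2 * h) * char_poly (adjacency_matrix (S_graph h a) vs)
    = monom 1 (2 * h * a) * list_det (\<lambda>u v.
        (if u = v then monom 1 2 - of_nat (c v) else 0)
        - (if (u, v) \<in> parcs (cycle_graph (2 * h)) then monom 1 1 else 0)) [1..<Suc (2 * h)] [1..<Suc (2 * h)]"
    using char_poly_attach_pendants[of vs "cycle_graph (2 * h)" c "[1..<Suc (2 * h)]"] assms
    by (simp add: S verts sum_c[unfolded One_nat_def] atLeastLessThanSuc_atLeastAtMost del: upt_Suc)
  also have "list_det (\<lambda>u v. (if u = v then monom 1 2 - of_nat (c v) else 0)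
        - (if (u, v) \<in> parcs (cycle_graph (2 * h)) then monom 1 1 else 0)) [1..<Suc (2 * h)] [1..<Suc (2 * h)]
    = monom 1 2 * (monom 1 2 - of_nat (2 * a) - 4) * (U a (h - 1))\<^sup>2"
    unfolding list_det_cycle[OF \<open>h \<ge> 2\<close>, of a, symmetric]
    by (rule list_det_cong) (auto simp: c_def)
  also have "monom 1 (2 * h * a) * (monom 1 2 * (monom 1 2 - of_nat (2 * a) - 4) * (U a (h - 1))\<^sup>2)
    = monom 1 (2 * h) * (monom 1 (2 * h * (a - 1) + 2) * (monom 1 2 - of_nat (2 * a) - 4) * (U a (h - 1))\<^sup>2)"
  proof -
    \<comment> \<open>Splits off the exponent \<open>2 * h\<close> that is cancelled at the end;
      \<open>a \<ge> 1\<close> makes the natural-number subtraction exact.\<close>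
    have "2 * h * a + 2 = 2 * h + (2 * h * (a - 1) + 2)"
      using \<open>a \<ge> 1\<close> by (cases a) (simp_all add: algebra_simps)
    then have "monom (1 :: real) (2 * h * a) * monom 1 2 = monom 1 (2 * h) * monom 1 (2 * h * (a - 1) + 2)"
      by (simp only: mult_monom mult_1)
    then show ?thesis
      by (simp only: mult.assoc[symmetric])
  qed
  finally show "char_poly (adjacency_matrix (S_graph h a) vs) =
      monom 1 (2 * h * (a - 1) + 2) * (monom 1 2 - of_nat (2 * a) - 4) * (U a (h - 1))\<^sup>2"
    by (subst (asm) mult_left_cancel) (simp_all add: monom_eq_0_iff)
qed

end
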